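(* Let $\lambda\in\mathbb C\setminus\{0\}$, let $a$ be a positive integer and let $R\in x^{a}\mathbb C\{x,y\}$. Consider $X_R=\lambda x\frac{\partial}{\partial x}+(1+R)y\frac{\partial}{\partial y}$ on a polydisc $\mathcal U=\rho\mathbb D\times r\mathbb D$ on which $R$ is holomorphic, bounded, and satisfies $\sup_{\mathcal U}|R|<1$. Let $\mathcal E:(z,w)\mapsto(e^{z},e^{w})$ be the universal covering of $\hat{\mathcal U}=\mathcal U\setminus\{xy=0\}$ by $\tilde{\mathcal U}=\{\operatorname{Re} z<\ln\rho,\ \operatorname{Re} w<\ln r\}$. Then the pulled-back foliation $\mathcal E^{*}\mathcal F_R$ on $\tilde{\mathcal U}$ is regular (nonsingular), and each of its leaves is simply connected.
   Context: $\mathcal F_R$ denotes the holomorphic foliation of $\mathcal U$ whose leaves are the integral curves of $X_R$. The foliation $\mathcal E^{*}\mathcal F_R$ on $\tilde{\mathcal U}$ is the foliation by integral curves of $\mathcal E^{*}X_R=\lambda\frac{\partial}{\partial z}+(1+R\circ\mathcal E)\frac{\partial}{\partial w}$. *)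

theory Defs
  imports "HOL-Analysis.Analysis"
begin

definition holo2 :: "(complex \<times> complex \<Rightarrow> complex) \<Rightarrow> (complex \<times> complex) set \<Rightarrow> bool" where
  "holo2 f S \<longleftrightarrow> (\<forall>p\<in>S. \<exists>a b. (f has_derivative (\<lambda>(h, k). a * h + b * k)) (at p))"

definition polydisc :: "real \<Rightarrow> real \<Rightarrow> (complex \<times> complex) set" where
  "polydisc \<rho> r = {(x, y). norm x < \<rho> \<and> norm y < r}"

definition cover_dom :: "real \<Rightarrow> real \<Rightarrow> (complex \<times> complex) set" where
  "cover_dom \<rho> r = {(z, w). Re z < ln \<rho> \<and> Re w < ln r}"

definition covE :: "complex \<times> complex \<Rightarrow> complex \<times> complex" where
  "covE p = (exp (fst p), exp (snd p))"

definition pullback_field :: "complex \<Rightarrow> (complex \<times> complex \<Rightarrow> complex) \<Rightarrow> complex \<times> complex \<Rightarrow> complex \<times> complex" where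
  "pullback_field lam R p = (lam, 1 + R (covE p))"

definition integral_curve :: "(complex \<times> complex \<Rightarrow> complex \<times> complex) \<Rightarrow> (complex \<times> complex) set
    \<Rightarrow> complex set \<Rightarrow> (complex \<Rightarrow> complex \<times> complex) \<Rightarrow> bool" where
  "integral_curve V S D \<gamma> \<longleftrightarrow> open D \<and> connected D \<and> \<gamma> ` D \<subseteq> S \<and>
     (\<forall>t\<in>D. (\<gamma> has_derivative (\<lambda>h. (h * fst (V (\<gamma> t)), h * snd (V (\<gamma> t))))) (at t))"

text \<open>The leaf topology of the foliation by integral curves of V on S: generated by the
  images of open pieces of integral curves (plaques).\<close>
definition leaf_topology :: "(complex \<times> complex \<Rightarrow> complex \<times> complex) \<Rightarrow> (complex \<times> complex) set
    \<Rightarrow> (complex \<times> complex) topology" where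
  "leaf_topology V S = topology_generated_by
     {\<gamma> ` W | \<gamma> D W. integral_curve V S D \<gamma> \<and> open W \<and> W \<subseteq> D}"

definition leaf :: "(complex \<times> complex \<Rightarrow> complex \<times> complex) \<Rightarrow> (complex \<times> complex) set
    \<Rightarrow> complex \<times> complex \<Rightarrow> (complex \<times> complex) set" where
  "leaf V S p = connected_component_of_set (leaf_topology V S) p"

definition simply_connected_space :: "'a topology \<Rightarrow> bool" where
  "simply_connected_space X \<longleftrightarrow> path_connected_space X \<and>
     (\<forall>g. pathin X g \<and> g 1 = g 0 \<longrightarrow>
        homotopic_with (\<lambda>h. h 1 = h 0) (top_of_set {0..1}) X g (\<lambda>_. g 0))"

end

theory Submission
  imports Defs "HOL-Complex_Analysis.Complex_Analysis"
begin

text \<open>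
  Parametrise by the time \<open>t = z / lam\<close>: integral curves become graphs of solutions of
  \<open>w' = 1 + R (exp (lam * t), exp w)\<close> over open subsets of the half plane
  \<open>H = {t. Re (lam * t) < ln \<rho>}\<close>. As \<open>sup \<bar>R\<bar> < 1\<close>, the real part of \<open>w\<close> decreases when \<open>t\<close> moves
  backwards along the reals, so a solution can always be continued backwards as long as \<open>t\<close> stays
  in \<open>H\<close>. Two connected open subsets of \<open>H\<close> that are closed under backward translation have a
  connected intersection, because paths can be slid back onto a common transversal line. Hence
  solutions over such sets glue, and every leaf is the graph of one maximal solution over such a
  set. The same sliding contracts every loop in the base of the graph.
\<close>

subsection \<open>Subsets of a half plane closed under backward translation\<close>

definition half_plane :: "complex \<Rightarrow> real \<Rightarrow> complex set" where
  "half_plane lam \<kappa> = {t. Re (lam * t) < \<kappa>}"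

text \<open>Only translates that stay in \<open>H\<close> are tested: for \<open>Re lam < 0\<close>,
  moving to the left increases \<open>Re (lam * t)\<close> and eventually leaves the half
  plane.\<close>

definition backward_closed :: "complex set \<Rightarrow> complex set \<Rightarrow> bool" where
  "backward_closed H U \<longleftrightarrow> (\<forall>t\<in>U. \<forall>s\<ge>0. t - of_real s \<in> H \<longrightarrow> t - of_real s \<in> U)"

lemma open_half_plane: "open (half_plane lam \<kappa>)"
  unfolding half_plane_def by (intro open_Collect_less continuous_intros)

lemma convex_half_plane: "convex (half_plane lam \<kappa>)"
proof -
  have "half_plane lam \<kappa> = {t. inner (cnj lam) t < \<kappa>}"
    by (simp add: half_plane_def inner_complex_def)
  then show ?thesis
    by (simp add: convex_halfspace_lt)
qed

lemma backward_closedD: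
  assumes "backward_closed H U" "t \<in> U" "p \<in> H" "Im p = Im t" "Re p \<le> Re t"
  shows "p \<in> U"
proof -
  have "p = t - of_real (Re t - Re p)"
    using assms by (simp add: complex_eq_iff)
  then show ?thesis
    using assms unfolding backward_closed_def by (metis diff_ge_0_iff_ge)
qed

text \<open>The map \<open>t \<mapsto> b + Im t * d\<close> slides \<open>A\<close> backwards, inside the half plane, onto a single
  transversal line: parallel to the boundary if \<open>Re lam < 0\<close>, vertical otherwise.\<close>

lemma half_plane_push_back:
  assumes "compact A" "A \<subseteq> half_plane lam \<kappa>"
  obtains b d where
    "\<And>t. t \<in> A \<Longrightarrow> Im (b + of_real (Im t) * d) = Im t \<and> Re (b + of_real (Im t) * d) \<le> Re t
      \<and> b + of_real (Im t) * d \<in> half_plane lam \<kappa>"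
proof (cases "A = {}")
  case True
  then show ?thesis using that by blast
next
  case False
  show ?thesis
  proof (cases "Re lam \<ge> 0")
    case True
    have "compact (Re ` A)"
      by (intro compact_continuous_image continuous_intros assms)
    then obtain m where m: "\<And>t. t \<in> A \<Longrightarrow> m \<le> Re t"
      by (metis False compact_attains_inf image_eqI image_is_empty)
    show ?thesis
    \<comment> \<open>For \<open>Re lam \<ge> 0\<close>, lowering the real part never increases
      \<open>Re (lam * t)\<close>, so sliding to the vertical line at the minimum \<open>m\<close>
      of the real parts on \<open>A\<close> stays in the half plane.\<close>
    proof (rule that[of "of_real m" \<i>])
      fix t assume t: "t \<in> A"
      have "Re lam * m \<le> Re lam * Re t"
        using m[OF t] True by (rule mult_left_mono)
      then show "Im (of_real m + of_real (Im t) * \<i>) = Im t \<and>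
          Re (of_real m + of_real (Im t) * \<i>) \<le> Re t
          \<and> of_real m + of_real (Im t) * \<i> \<in> half_plane lam \<kappa>"
        using t m[OF t] assms(2) by (auto simp: half_plane_def)
    qed
  next
    case neg: False
    have "compact ((\<lambda>t. Re (lam * t)) ` A)"
      by (intro compact_continuous_image continuous_intros assms)
    then obtain t0 where t0: "t0 \<in> A" "\<And>t. t \<in> A \<Longrightarrow> Re (lam * t) \<le> Re (lam * t0)"
      using compact_attains_sup[of "(\<lambda>t. Re (lam * t)) ` A"] False by auto
    define q where "q = Re (lam * t0)"
    have q: "q < \<kappa>" "\<And>t. t \<in> A \<Longrightarrow> Re (lam * t) \<le> q"
      using t0 assms(2) by (auto simp: half_plane_def q_def)
    show ?thesis
    \<comment> \<open>This is the line \<open>Re (lam * z) = q\<close>, parametrised by the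
      imaginary part. Dividing by the negative \<open>Re lam\<close> reverses the inequality and
      puts its point no further right than \<open>t\<close>.\<close>
    proof (rule that[of "of_real (q / Re lam)" "Complex (Im lam / Re lam) 1"])
      fix t assume t: "t \<in> A"
      have "Re lam * Re t \<le> q + Im lam * Im t"
        using q(2)[OF t] by simp
      then have "(q + Im lam * Im t) / Re lam \<le> Re t"
        using neg by (simp add: divide_simps mult.commute)
      moreover have "Re lam * (q / Re lam + Im t * Im lam / Re lam) - Im lam * Im t = q"
        using neg by (simp add: field_simps)
      ultimately show "Im (of_real (q / Re lam) + of_real (Im t) * Complex (Im lam / Re lam) 1) = Im t \<and>
          Re (of_real (q / Re lam) + of_real (Im t) * Complex (Im lam / Re lam) 1) \<le> Re t
          \<and> of_real (q / Re lam) + of_real (Im t) * Complex (Im lam / Re lam) 1 \<in> half_plane lam \<kappa>"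
        using q(1) by (simp add: half_plane_def add_divide_distrib mult.commute)
    qed
  qed
qed

text \<open>Convexity of \<open>H\<close> keeps the horizontal track from \<open>t\<close> back to
  \<open>p\<close> in \<open>H\<close>; backward closedness then keeps it in
  \<open>U\<close>.\<close>

lemma backward_closed_segment:
  assumes "backward_closed H U" "convex H" "U \<subseteq> H" "t \<in> U" "p \<in> H" "Im p = Im t" "Re p \<le> Re t"
  shows "closed_segment t p \<subseteq> U"
proof
  fix x assume x: "x \<in> closed_segment t p"
  then obtain u where u: "0 \<le> u" "u \<le> 1" "x = (1 - u) *\<^sub>R t + u *\<^sub>R p"
    by (auto simp: closed_segment_def)
  have "x \<in> H"
    using x assms closed_segment_subset by blast
  moreover have "Im x = Im t"
    unfolding u(3) using assms by (simp add: algebra_simps)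
  moreover have "Re x \<le> Re t"
    unfolding u(3) using u(1) assms mult_left_mono[of "Re p" "Re t" u] by (simp add: algebra_simps)
  ultimately show "x \<in> U"
    using assms backward_closedD by blast
qed

text \<open>The imaginary parts of a connected set form an interval, so each point of the
  transversal segment lies straight behind some point of \<open>A\<close>.\<close>

lemma backward_closed_cross_segment:
  assumes "backward_closed H U" "A \<subseteq> U" "connected A" "s \<in> A" "t \<in> A"
    and P: "\<And>t. t \<in> A \<Longrightarrow> Im (b + of_real (Im t) * d) = Im t \<and> Re (b + of_real (Im t) * d) \<le> Re t
      \<and> b + of_real (Im t) * d \<in> H"
  shows "closed_segment (b + of_real (Im s) * d) (b + of_real (Im t) * d) \<subseteq> U"
proof
  fix x assume "x \<in> closed_segment (b + of_real (Im s) * d) (b + of_real (Im t) * d)"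
  then obtain u where u: "0 \<le> u" "u \<le> 1"
      "x = (1 - u) *\<^sub>R (b + of_real (Im s) * d) + u *\<^sub>R (b + of_real (Im t) * d)"
    by (auto simp: closed_segment_def)
  define y where "y = (1 - u) *\<^sub>R Im s + u *\<^sub>R Im t"
  have x: "x = b + of_real y * d"
    unfolding u(3) y_def by (simp add: scaleR_conv_of_real algebra_simps)
  have "convex (Im ` A)"
    unfolding is_interval_convex_1[symmetric] is_interval_connected_1
    by (intro connected_continuous_image continuous_intros assms)
  then have "y \<in> Im ` A"
    unfolding y_def using u assms by (intro convexD) auto
  then obtain a where "a \<in> A" "y = Im a"
    by auto
  then show "x \<in> U"
    using x P backward_closedD[OF assms(1), of a x] assms(2) by auto
qed

text \<open>Join two common points \<open>s\<close> and \<open>t\<close> by a path in each set and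
  slide both paths back. The detour \<open>s\<close>, \<open>Q s\<close>, \<open>Q t\<close>,
  \<open>t\<close> lies in \<open>U\<close> because of the first path and in \<open>V\<close>
  because of the second.\<close>

lemma connected_Int_backward_closed:
  assumes U: "open U" "connected U" "backward_closed (half_plane lam \<kappa>) U" "U \<subseteq> half_plane lam \<kappa>"
    and V: "open V" "connected V" "backward_closed (half_plane lam \<kappa>) V" "V \<subseteq> half_plane lam \<kappa>"
  shows "connected (U \<inter> V)"
proof -
  have "\<exists>T. connected T \<and> T \<subseteq> U \<inter> V \<and> s \<in> T \<and> t \<in> T" if st: "s \<in> U \<inter> V" "t \<in> U \<inter> V" for s t
  proof -
    obtain g where g: "path g" "path_image g \<subseteq> U" "pathstart g = s" "pathfinish g = t"
      using U st by (meson IntD1 connected_open_path_connected path_connected_def)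
    obtain h where h: "path h" "path_image h \<subseteq> V" "pathstart h = s" "pathfinish h = t"
      using V st by (meson IntD2 connected_open_path_connected path_connected_def)
    have mem: "s \<in> path_image g" "t \<in> path_image g" "s \<in> path_image h" "t \<in> path_image h"
      using g h pathstart_in_path_image pathfinish_in_path_image by metis+
    \<comment> \<open>One line has to serve both paths: then both give the same segment from
      \<open>Q s\<close> to \<open>Q t\<close>.\<close>
    obtain b d where P: "\<And>t. t \<in> path_image g \<union> path_image h \<Longrightarrow>
        Im (b + of_real (Im t) * d) = Im t \<and> Re (b + of_real (Im t) * d) \<le> Re t
        \<and> b + of_real (Im t) * d \<in> half_plane lam \<kappa>"
    proof (rule half_plane_push_back)
      show "compact (path_image g \<union> path_image h)"
        using g h by (intro compact_Un compact_path_image)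
      show "path_image g \<union> path_image h \<subseteq> half_plane lam \<kappa>"
        using g h U V by blast
    qed blast
    define Q where "Q t = b + of_real (Im t) * d" for t :: complex
    have seg: "closed_segment (Q s) (Q t) \<subseteq> U \<inter> V"
      unfolding Q_def
      using backward_closed_cross_segment[OF U(3) g(2) connected_path_image[OF g(1)] mem(1,2), of b d]
        backward_closed_cross_segment[OF V(3) h(2) connected_path_image[OF h(1)] mem(3,4), of b d] P
      by auto
    have side: "closed_segment x (Q x) \<subseteq> U \<inter> V" if "x \<in> {s, t}" for x
      using backward_closed_segment[OF U(3) convex_half_plane U(4), of x "Q x"]
        backward_closed_segment[OF V(3) convex_half_plane V(4), of x "Q x"]
        P[of x] that st mem unfolding Q_def by blast
    have "connected (closed_segment s (Q s) \<union> closed_segment (Q s) (Q t))"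
      by (rule connected_Un) auto
    then have "connected ((closed_segment s (Q s) \<union> closed_segment (Q s) (Q t)) \<union> closed_segment t (Q t))"
      by (rule connected_Un) auto
    then show ?thesis
      using seg side[of s] side[of t]
      by (intro exI[of _ "closed_segment s (Q s) \<union> closed_segment (Q s) (Q t) \<union> closed_segment t (Q t)"])
        auto
  qed
  then show ?thesis
    by (subst connected_iff_connected_component) (simp add: connected_component_def)
qed

text \<open>A loop is contracted in two linear stages: horizontally back to the transversal, then
  along the transversal to \<open>Q (p 0)\<close>.\<close>

lemma simply_connected_backward_closed:
  assumes U: "open U" "connected U" "backward_closed (half_plane lam \<kappa>) U" "U \<subseteq> half_plane lam \<kappa>"
  shows "simply_connected U"
  unfolding simply_connected_eq_contractible_loop_some
proof (intro conjI allI impI)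
  show "path_connected U"
    using U connected_open_path_connected by blast
  fix p assume p: "path p \<and> path_image p \<subseteq> U \<and> pathfinish p = pathstart p"
  obtain b d where P: "\<And>t. t \<in> path_image p \<Longrightarrow>
      Im (b + of_real (Im t) * d) = Im t \<and> Re (b + of_real (Im t) * d) \<le> Re t
      \<and> b + of_real (Im t) * d \<in> half_plane lam \<kappa>"
  proof (rule half_plane_push_back)
    show "compact (path_image p)"
      using p by (intro compact_path_image) auto
    show "path_image p \<subseteq> half_plane lam \<kappa>"
      using p U by blast
  qed blast
  define Q where "Q t = b + of_real (Im t) * d" for t :: complex
  have contQ: "continuous_on UNIV Q"
    unfolding Q_def by (intro continuous_intros)
  have mem: "p x \<in> path_image p" if "x \<in> {0..1}" for x
    using that by (auto simp: path_image_def)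
  have 1: "homotopic_loops U p (Q \<circ> p)"
  proof (rule homotopic_loops_linear)
    show "path (Q \<circ> p)"
      using p contQ continuous_on_subset path_continuous_image by blast
    show "closed_segment (p x) ((Q \<circ> p) x) \<subseteq> U" if "x \<in> {0..1}" for x
      using backward_closed_segment[OF U(3) convex_half_plane U(4), of "p x" "Q (p x)"]
        P[OF mem[OF that]] mem[OF that] p unfolding Q_def by auto
  qed (use p in \<open>auto simp: pathfinish_def pathstart_def\<close>)
  have seg: "closed_segment (Q (p x)) (Q (p 0)) \<subseteq> U" if "x \<in> {0..1}" for x
    unfolding Q_def
    using backward_closed_cross_segment[OF U(3) _ connected_path_image, of p "p x" "p 0" b d] P p
      mem[OF that] mem[of 0] by auto
  have 2: "homotopic_loops U (Q \<circ> p) (linepath (Q (p 0)) (Q (p 0)))"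
  proof (rule homotopic_loops_linear)
    show "path (Q \<circ> p)"
      using p contQ continuous_on_subset path_continuous_image by blast
    show "closed_segment ((Q \<circ> p) x) (linepath (Q (p 0)) (Q (p 0)) x) \<subseteq> U" if "x \<in> {0..1}" for x
      using seg[OF that] by (simp add: linepath_def algebra_simps flip: scaleR_left.add)
  qed (use p in \<open>auto simp: pathfinish_def pathstart_def\<close>)
  show "\<exists>a. a \<in> U \<and> homotopic_loops U p (linepath a a)"
    using 1 2 seg[of 0] homotopic_loops_trans by (intro exI[of _ "Q (p 0)"]) auto
qed

subsection \<open>Solutions of the differential equation\<close>

text \<open>Integrating along the segment from \<open>t0\<close> to \<open>t\<close> gives
  \<open>K * (exp (L * norm (t - t0)) - 1)\<close>. Passing from \<open>v'\<close> to
  \<open>v\<close> thus gains a factor \<open>1 / L\<close>, which makes Picard iteration contract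
  on domains of any size.\<close>

lemma norm_le_exp_if_deriv_le_exp:
  fixes v v' :: "complex \<Rightarrow> complex"
  assumes D: "convex D" "t0 \<in> D" "t \<in> D" and "v t0 = 0" "K \<ge> 0"
    and der: "\<And>s. s \<in> D \<Longrightarrow> (v has_field_derivative v' s) (at s)"
    and bound: "\<And>s. s \<in> D \<Longrightarrow> norm (v' s) \<le> K * L * exp (L * norm (s - t0))"
  shows "norm (v t) \<le> K * exp (L * norm (t - t0))"
proof -
  define p where "p x = t0 + of_real x * (t - t0)" for x :: real
  have pD: "p x \<in> D" if "x \<in> {0..1}" for x
    using convexD_alt[OF D, of x] that by (simp add: p_def scaleR_conv_of_real algebra_simps)
  have vp: "((\<lambda>x. v (p x)) has_vector_derivative (t - t0) * v' (p x)) (at x)" if "x \<in> {0..1}" for x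
  proof -
    have "(p has_vector_derivative (t - t0)) (at x)"
      unfolding p_def by (auto intro!: derivative_eq_intros)
    from field_vector_diff_chain_at[OF this der[OF pD[OF that]]]
    show ?thesis by (simp add: o_def)
  qed
  define \<phi> where "\<phi> x = K * exp (L * norm (t - t0) * x)" for x :: real
  define \<phi>' where "\<phi>' x = K * (L * norm (t - t0)) * exp (L * norm (t - t0) * x)" for x :: real
  have \<phi>: "(\<phi> has_vector_derivative \<phi>' x) (at x)" for x
    unfolding \<phi>_def \<phi>'_def
    by (auto intro!: derivative_eq_intros simp flip: has_real_derivative_iff_has_vector_derivative)
  have "norm (v (p 1) - v (p 0)) \<le> \<phi> 1 - \<phi> 0"
  proof (rule differentiable_bound_general[where f = "\<lambda>x. v (p x)"])
    show "continuous_on {0..1} (\<lambda>x. v (p x))"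
      using vp by (meson continuous_at_imp_continuous_on has_vector_derivative_continuous)
    show "continuous_on {0..1} \<phi>"
      unfolding \<phi>_def by (intro continuous_intros)
    fix x :: real assume x: "0 < x" "x < 1"
    have "norm (p x - t0) = x * norm (t - t0)"
      using x by (simp add: p_def norm_mult)
    moreover have "norm (v' (p x)) \<le> K * L * exp (L * norm (p x - t0))"
      using x by (intro bound pD) auto
    ultimately have "norm (t - t0) * norm (v' (p x)) \<le> norm (t - t0) * (K * L * exp (L * (x * norm (t - t0))))"
      by (intro mult_left_mono) auto
    then show "norm ((t - t0) * v' (p x)) \<le> \<phi>' x"
      unfolding \<phi>'_def norm_mult by (simp add: algebra_simps)
  qed (use vp \<phi> in auto)
  moreover have "p 1 = t" "p 0 = t0" "\<phi> 0 = K" "\<phi> 1 = K * exp (L * norm (t - t0))"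
    by (auto simp: p_def \<phi>_def)
  ultimately show ?thesis
    using assms by simp
qed

text \<open>\<open>F t w\<close> abstracts \<open>1 + R (exp (lam * t), exp w)\<close>. Its values
  lie in a disc around \<open>1\<close> of radius \<open>c < 1\<close>, hence have positive real
  part. The Lipschitz constant depends on \<open>m\<close> because Cauchy estimates deteriorate near
  \<open>Re w = \<mu>\<close>.\<close>

locale forward_ode =
  fixes lam :: complex and \<kappa> \<mu> c :: real and F :: "complex \<Rightarrow> complex \<Rightarrow> complex"
  assumes c: "0 \<le> c" "c < 1"
    and F_holo: "\<And>U u. open U \<Longrightarrow> U \<subseteq> half_plane lam \<kappa> \<Longrightarrow> u holomorphic_on U \<Longrightarrow>
        (\<And>t. t \<in> U \<Longrightarrow> Re (u t) < \<mu>) \<Longrightarrow> (\<lambda>t. F t (u t)) holomorphic_on U"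
    and F_near_one: "\<And>t w. t \<in> half_plane lam \<kappa> \<Longrightarrow> Re w < \<mu> \<Longrightarrow> norm (F t w - 1) \<le> c"
    and F_Lipschitz: "\<And>m. m < \<mu> \<Longrightarrow> \<exists>M>0. \<forall>t\<in>half_plane lam \<kappa>. \<forall>w w'.
        Re w \<le> m \<longrightarrow> Re w' \<le> m \<longrightarrow> norm (F t w - F t w') \<le> M * norm (w - w')"
begin

abbreviation "H \<equiv> half_plane lam \<kappa>"

text \<open>\<open>U\<close> may be disconnected, since plaques are images of arbitrary open pieces
  of integral curves.\<close>

definition solution :: "complex set \<Rightarrow> (complex \<Rightarrow> complex) \<Rightarrow> bool" where
  "solution U f \<longleftrightarrow> open U \<and> U \<subseteq> H \<and>
     (\<forall>t\<in>U. Re (f t) < \<mu> \<and> (f has_field_derivative F t (f t)) (at t))"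

section \<open>Uniqueness and gluing of solutions\<close>

lemma solution_subset: "solution U f \<Longrightarrow> V \<subseteq> U \<Longrightarrow> open V \<Longrightarrow> solution V f"
  by (auto simp: solution_def)

lemma solution_continuous_on: "solution U f \<Longrightarrow> continuous_on U f"
  unfolding solution_def by (meson DERIV_isCont continuous_at_imp_continuous_on)

text \<open>On a closed ball of radius \<open>e\<close> with \<open>M * e \<le> 1/2\<close>, the
  maximum of \<open>norm (f t - g t)\<close> is at most half of itself, so it vanishes.\<close>

lemma solutions_agree_locally:
  assumes "solution U f" "solution U g" "t0 \<in> U" "f t0 = g t0"
  obtains e where "e > 0" "ball t0 e \<subseteq> U" "\<And>t. t \<in> ball t0 e \<Longrightarrow> f t = g t"
proof -
  have U: "open U" "U \<subseteq> H"
    using assms by (auto simp: solution_def)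
  obtain d where d: "d > 0" "cball t0 d \<subseteq> U"
    using U assms open_contains_cball by blast
  have cf: "continuous_on (cball t0 d) f" and cg: "continuous_on (cball t0 d) g"
    using assms d solution_continuous_on continuous_on_subset by blast+
  have "compact ((\<lambda>t. max (Re (f t)) (Re (g t))) ` cball t0 d)"
    by (intro compact_continuous_image continuous_intros cf cg) auto
  then obtain s where s: "s \<in> cball t0 d"
      "\<And>t. t \<in> cball t0 d \<Longrightarrow> max (Re (f t)) (Re (g t)) \<le> max (Re (f s)) (Re (g s))"
    using compact_attains_sup[of "(\<lambda>t. max (Re (f t)) (Re (g t))) ` cball t0 d"] d by auto
  \<comment> \<open>Both solutions have real part at most \<open>m < \<mu>\<close> on the compact
    ball, so one Lipschitz constant serves for the two.\<close>
  define m where "m = max (Re (f s)) (Re (g s))"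
  have "m < \<mu>"
    using s d assms by (auto simp: m_def solution_def)
  then obtain M where M: "M > 0" "\<And>t w w'. \<lbrakk>t \<in> H; Re w \<le> m; Re w' \<le> m\<rbrakk> \<Longrightarrow>
      norm (F t w - F t w') \<le> M * norm (w - w')"
    using F_Lipschitz by metis
  define e where "e = min d (1 / (2 * M))"
  have e: "e > 0" "e \<le> d" "M * e \<le> 1/2"
    using d M by (auto simp: e_def min_def field_simps)
  have "continuous_on (cball t0 e) (\<lambda>t. norm (f t - g t))"
    using cf cg e by (intro continuous_intros) (auto intro: continuous_on_subset)
  then obtain x where x: "x \<in> cball t0 e" "\<And>t. t \<in> cball t0 e \<Longrightarrow> norm (f t - g t) \<le> norm (f x - g x)"
    using continuous_attains_sup[of "cball t0 e" "\<lambda>t. norm (f t - g t)"] e by auto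
  have "norm ((f x - g x) - (f t0 - g t0)) \<le> M * norm (f x - g x) * norm (x - t0)"
  proof (rule field_differentiable_bound[where S = "cball t0 e" and f' = "\<lambda>t. F t (f t) - F t (g t)"])
    fix t assume t: "t \<in> cball t0 e"
    then have td: "t \<in> cball t0 d" and tU: "t \<in> U"
      using e d by auto
    show "((\<lambda>t. f t - g t) has_field_derivative F t (f t) - F t (g t)) (at t within cball t0 e)"
      using assms tU unfolding solution_def
      by (intro DERIV_diff) (auto intro: has_field_derivative_at_within)
    have "norm (F t (f t) - F t (g t)) \<le> M * norm (f t - g t)"
      using M(2)[of t "f t" "g t"] s(2)[OF td] U tU by (auto simp: m_def)
    also have "\<dots> \<le> M * norm (f x - g x)"
      using x(2)[OF t] M by (intro mult_left_mono) auto
    finally show "norm (F t (f t) - F t (g t)) \<le> M * norm (f x - g x)" .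
  qed (use e x in auto)
  also have "\<dots> \<le> M * norm (f x - g x) * e"
    using M x by (intro mult_left_mono) (auto simp: dist_norm norm_minus_commute)
  also have "\<dots> = (M * e) * norm (f x - g x)"
    by simp
  also have "\<dots> \<le> (1/2) * norm (f x - g x)"
    using e by (intro mult_right_mono) auto
  finally have "norm (f x - g x) \<le> 0"
    using assms by simp
  then have eq: "f t = g t" if "t \<in> ball t0 e" for t
    using x(2)[of t] that by auto
  show ?thesis
    by (rule that[OF e(1)]) (use e d eq in auto)
qed

text \<open>Local uniqueness makes the coincidence set open, and continuity makes it closed in
  \<open>U\<close>.\<close>

lemma solutions_agree:
  assumes f: "solution U f" and g: "solution U g" and "connected U"
    and "t0 \<in> U" "f t0 = g t0" "t \<in> U"
  shows "f t = g t"
proof -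
  define E where "E = {t\<in>U. f t - g t = 0}"
  have "open E"
    unfolding open_contains_ball
  proof
    fix s assume "s \<in> E"
    then show "\<exists>e>0. ball s e \<subseteq> E"
      using solutions_agree_locally[OF f g, of s] unfolding E_def
      by (smt (verit) mem_Collect_eq subset_iff right_minus_eq)
  qed
  moreover have "closedin (top_of_set U) E"
    unfolding E_def using f g solution_continuous_on
    by (intro continuous_closedin_preimage_constant continuous_intros) auto
  moreover have "E \<subseteq> U" "t0 \<in> E"
    using assms by (auto simp: E_def)
  ultimately have "E = U"
    using \<open>connected U\<close> unfolding connected_clopen by (metis empty_iff open_subset)
  then show ?thesis
    using \<open>t \<in> U\<close> by (auto simp: E_def)
qed

text \<open>Connectedness of the overlap spreads the agreement at \<open>t0\<close> to all of
  \<open>U \<inter> V\<close>.\<close>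

lemma solution_glue:
  assumes f: "solution U f" and g: "solution V g" and conn: "connected (U \<inter> V)"
    and "t0 \<in> U \<inter> V" "f t0 = g t0"
  shows "solution (U \<union> V) (\<lambda>t. if t \<in> U then f t else g t)" (is "solution _ ?h")
    and "\<And>t. t \<in> U \<inter> V \<Longrightarrow> f t = g t"
proof -
  have op: "open U" "open V"
    using f g by (auto simp: solution_def)
  show eq: "f t = g t" if "t \<in> U \<inter> V" for t
    using solutions_agree[of "U \<inter> V" f g t0 t] solution_subset[OF f, of "U \<inter> V"]
      solution_subset[OF g, of "U \<inter> V"] assms that op by auto
  have "Re (?h t) < \<mu> \<and> (?h has_field_derivative F t (?h t)) (at t)" if "t \<in> U" for t
    using f that has_field_derivative_transform_within_open[of f "F t (f t)" t U ?h] op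
    by (auto simp: solution_def)
  moreover have "Re (?h t) < \<mu> \<and> (?h has_field_derivative F t (?h t)) (at t)" if "t \<in> V" for t
    using g that eq has_field_derivative_transform_within_open[of g "F t (g t)" t V ?h] op
    by (auto simp: solution_def)
  ultimately show "solution (U \<union> V) ?h"
    using f g op unfolding solution_def by blast
qed

section \<open>Local existence by Picard iteration\<close>

lemma solution_exists:
  assumes t0: "t0 \<in> H" and w0: "Re w0 < \<mu>"
  obtains D f where "solution D f" "connected D" "backward_closed H D" "t0 \<in> D" "f t0 = w0"
proof -
  \<comment> \<open>A level strictly between \<open>Re w0\<close> and \<open>\<mu>\<close>: iterates
    will stay below it, so a single Lipschitz constant \<open>M\<close> serves for all of
    them.\<close>
  define m where "m = (Re w0 + \<mu>) / 2"
  have m: "Re w0 < m" "m < \<mu>"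
    using w0 by (auto simp: m_def)
  obtain M where M: "M > 0" "\<And>t w w'. \<lbrakk>t \<in> H; Re w \<le> m; Re w' \<le> m\<rbrakk> \<Longrightarrow>
      norm (F t w - F t w') \<le> M * norm (w - w')"
    using F_Lipschitz[OF m(2)] by metis
  \<comment> \<open>Since \<open>F\<close> takes values in the disc of radius \<open>c\<close> around \<open>1\<close>, every Picard iterate satisfies
    \<open>Re (u t) \<le> Re w0 + Re (t - t0) + c * norm (t - t0)\<close>. On the following convex set the iterates
    therefore never leave the domain of \<open>F\<close>.\<close>
  define D where "D = H \<inter> {t. Re (t - t0) + c * norm (t - t0) < m - Re w0}"
  have DH: "D \<subseteq> H" and t0D: "t0 \<in> D"
    using t0 m by (auto simp: D_def)
  have opD: "open D"
    unfolding D_def by (intro open_Int open_half_plane open_Collect_less continuous_intros)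
  \<comment> \<open>The defining function is affine plus \<open>c \<ge> 0\<close> times a norm,
    hence convex.\<close>
  have "convex {t. Re (t - t0) + c * norm (t - t0) < m - Re w0}"
    unfolding convex_alt
  proof (intro ballI allI impI, clarify)
    fix x y :: complex and u :: real
    assume x: "Re (x - t0) + c * norm (x - t0) < m - Re w0" and u: "0 \<le> u" "u \<le> 1"
      and y: "Re (y - t0) + c * norm (y - t0) < m - Re w0"
    have eq: "(1 - u) *\<^sub>R x + u *\<^sub>R y - t0 = (1 - u) *\<^sub>R (x - t0) + u *\<^sub>R (y - t0)"
      by (simp add: algebra_simps)
    have "norm ((1 - u) *\<^sub>R (x - t0) + u *\<^sub>R (y - t0)) \<le> (1 - u) * norm (x - t0) + u * norm (y - t0)"
      using u norm_triangle_ineq[of "(1 - u) *\<^sub>R (x - t0)" "u *\<^sub>R (y - t0)"] by simp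
    from mult_left_mono[OF this c(1)]
    have "Re ((1 - u) *\<^sub>R x + u *\<^sub>R y - t0) + c * norm ((1 - u) *\<^sub>R x + u *\<^sub>R y - t0)
        \<le> (1 - u) * (Re (x - t0) + c * norm (x - t0)) + u * (Re (y - t0) + c * norm (y - t0))"
      unfolding eq by (simp add: algebra_simps)
    also have "\<dots> < m - Re w0"
      using x y u by (intro convex_bound_lt) auto
    finally show "Re ((1 - u) *\<^sub>R x + u *\<^sub>R y - t0) + c * norm ((1 - u) *\<^sub>R x + u *\<^sub>R y - t0)
        < m - Re w0" .
  qed
  then have cvD: "convex D"
    unfolding D_def by (intro convex_Int convex_half_plane)
  have bcD: "backward_closed H D"
    unfolding backward_closed_def
  proof (intro ballI allI impI)
    fix t and s :: real assume *: "t \<in> D" "s \<ge> 0" "t - of_real s \<in> H"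
    \<comment> \<open>Going back by \<open>s\<close> lowers the real part by \<open>s\<close> and
      raises the weighted distance by at most \<open>c * s \<le> s\<close>.\<close>
    have "norm (t - of_real s - t0) \<le> norm (t - t0) + s"
      using norm_triangle_ineq4[of "t - t0" "of_real s"] *(2) by (simp add: algebra_simps)
    then have "c * norm (t - of_real s - t0) \<le> c * norm (t - t0) + c * s"
      using c mult_left_mono[of "norm (t - of_real s - t0)" "norm (t - t0) + s" c] by (simp add: algebra_simps)
    moreover have "c * s \<le> s"
      using c *(2) mult_right_mono[of c 1 s] by simp
    ultimately show "t - of_real s \<in> D"
      using * unfolding D_def by auto
  qed
  define adm where "adm u \<longleftrightarrow> u holomorphic_on D \<and> u t0 = w0 \<and>
      (\<forall>t\<in>D. norm (u t - w0 - (t - t0)) \<le> c * norm (t - t0))" for u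
  have below: "Re w \<le> m" if "t \<in> D" "norm (w - w0 - (t - t0)) \<le> c * norm (t - t0)" for w t
    using that complex_Re_le_cmod[of "w - w0 - (t - t0)"] by (auto simp: D_def)
  have step: "\<exists>v. adm v \<and> (\<forall>t\<in>D. (v has_field_derivative F t (u t)) (at t))" if u: "adm u" for u
  proof -
    have u\<mu>: "Re (u t) < \<mu>" if "t \<in> D" for t
      using below[OF that, of "u t"] u that m by (auto simp: adm_def)
    have hol: "(\<lambda>t. F t (u t)) holomorphic_on D"
      using u u\<mu> by (intro F_holo opD DH) (auto simp: adm_def)
    \<comment> \<open>By convexity of \<open>D\<close>, Cauchy's theorem provides a primitive, which
      replaces the integral of the Picard operator.\<close>
    obtain g where g: "\<And>t. t \<in> D \<Longrightarrow> (g has_field_derivative F t (u t)) (at t within D)"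
    proof (rule holomorphic_convex_primitive[OF cvD finite.emptyI])
      show "continuous_on D (\<lambda>t. F t (u t))"
        using hol by (rule holomorphic_on_imp_continuous_on)
      show "(\<lambda>t. F t (u t)) field_differentiable at x" if "x \<in> interior D - {}" for x
        using that hol opD by (simp add: interior_open holomorphic_on_imp_differentiable_at)
    qed (rule that)
    define v where "v t = g t - g t0 + w0" for t
    have v: "(v has_field_derivative F t (u t)) (at t)" if "t \<in> D" for t
    proof -
      have "(g has_field_derivative F t (u t)) (at t)"
        using g[OF that] at_within_open[OF that opD] by simp
      then show ?thesis
        unfolding v_def by (auto intro!: derivative_eq_intros)
    qed
    have "norm (v t - w0 - (t - t0)) \<le> c * norm (t - t0)" if t: "t \<in> D" for t
    proof -
      \<comment> \<open>The function \<open>v t - t\<close> has derivative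
        \<open>F t (u t) - 1\<close>, of norm at most \<open>c\<close>.\<close>
      have "norm ((v t - t) - (v t0 - t0)) \<le> c * norm (t - t0)"
      proof (rule field_differentiable_bound[OF cvD])
        fix s assume s: "s \<in> D"
        show "((\<lambda>t. v t - t) has_field_derivative F s (u s) - 1) (at s within D)"
          by (intro has_field_derivative_at_within[OF DERIV_diff] v[OF s] DERIV_ident)
        show "norm (F s (u s) - 1) \<le> c"
          using s DH u\<mu> by (intro F_near_one) auto
      qed (use t t0D in auto)
      then show ?thesis
        by (simp add: v_def algebra_simps)
    qed
    then have "adm v"
      using v opD unfolding adm_def holomorphic_on_open[OF opD] by (auto simp: v_def)
    then show ?thesis
      using v by blast
  qed
  \<comment> \<open>The iteration starts at the solution of \<open>w' = 1\<close>.\<close>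
  have "adm (\<lambda>t. w0 + (t - t0))"
    unfolding adm_def using c by (auto intro!: holomorphic_intros)
  then obtain u where u: "\<And>n. adm (u n)"
      "\<And>n t. t \<in> D \<Longrightarrow> (u (Suc n) has_field_derivative F t (u n t)) (at t)"
    using dependent_nat_choice[of "\<lambda>_. adm" "\<lambda>_ u v. \<forall>t\<in>D. (v has_field_derivative F t (u t)) (at t)"] step
    by metis
  have near: "norm (u n t - w0 - (t - t0)) \<le> c * norm (t - t0)" if "t \<in> D" for n t
    using u(1)[of n] that by (auto simp: adm_def)
  \<comment> \<open>Each step multiplies by the Lipschitz constant \<open>M\<close> and divides by
    the exponent \<open>2 * M\<close>, hence the ratio \<open>1/2\<close>. The factor
    \<open>1 / M\<close> comes from the base case, where
    \<open>2 * norm (t - t0) \<le> exp (2 * M * norm (t - t0)) / M\<close>.\<close>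
  have diff_bound: "norm (u (Suc n) t - u n t) \<le> (1/2)^n / M * exp (2 * M * norm (t - t0))"
    if "t \<in> D" for n t
    using that
  proof (induction n arbitrary: t)
    case 0
    have "norm (u 1 t - u 0 t) \<le> c * norm (t - t0) + c * norm (t - t0)"
      using norm_triangle_ineq4[of "u 1 t - w0 - (t - t0)" "u 0 t - w0 - (t - t0)"]
        near[OF 0, of 0] near[OF 0, of 1] by simp
    also have "\<dots> \<le> norm (t - t0) + norm (t - t0)"
      using c by (intro add_mono mult_left_le_one_le) auto
    also have "\<dots> \<le> exp (2 * M * norm (t - t0)) / M"
    proof -
      have "2 * M * norm (t - t0) \<le> exp (2 * M * norm (t - t0))"
        using exp_ge_add_one_self[of "2 * M * norm (t - t0)"] by linarith
      then show ?thesis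
        using M(1) by (simp add: field_simps)
    qed
    finally show ?case by simp
  next
    case (Suc n)
    have "norm ((\<lambda>t. u (Suc (Suc n)) t - u (Suc n) t) t) \<le> (1/2)^Suc n / M * exp ((2 * M) * norm (t - t0))"
    proof (rule norm_le_exp_if_deriv_le_exp[OF cvD t0D Suc.prems])
      show "u (Suc (Suc n)) t0 - u (Suc n) t0 = 0"
        using u(1)[of "Suc n"] u(1)[of "Suc (Suc n)"] by (simp add: adm_def)
      fix s assume s: "s \<in> D"
      show "((\<lambda>t. u (Suc (Suc n)) t - u (Suc n) t) has_field_derivative F s (u (Suc n) s) - F s (u n s)) (at s)"
        using u(2)[OF s] by (intro DERIV_diff)
      have "norm (F s (u (Suc n) s) - F s (u n s)) \<le> M * norm (u (Suc n) s - u n s)"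
        using s DH near by (intro M(2) below[OF s]) auto
      also have "\<dots> \<le> M * ((1/2)^n / M * exp (2 * M * norm (s - t0)))"
        using M by (intro mult_left_mono Suc.IH s) auto
      finally show "norm (F s (u (Suc n) s) - F s (u n s)) \<le>
          (1/2)^Suc n / M * (2 * M) * exp ((2 * M) * norm (s - t0))"
        using M by simp
    qed (use M in auto)
    then show ?case by simp
  qed
  \<comment> \<open>This telescoping series is the limit of the iterates; \<open>diff_bound\<close>
    makes it converge uniformly on closed balls in \<open>D\<close>.\<close>
  define f where "f t = u 0 t + (\<Sum>n. u (Suc n) t - u n t)" for t
  have unif: "uniform_limit (cball x d) u f sequentially" if "cball x d \<subseteq> D" for x d
  proof -
    have "uniform_limit (cball x d) (\<lambda>n t. \<Sum>i<n. u (Suc i) t - u i t) (\<lambda>t. \<Sum>n. u (Suc n) t - u n t) sequentially"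
    proof (rule Weierstrass_m_test)
      fix n t assume t: "t \<in> cball x d"
      have "norm (t - t0) \<le> d + norm (x - t0)"
        using t norm_triangle_ineq[of "t - x" "x - t0"] by (simp add: dist_norm norm_minus_commute)
      then have "exp (2 * M * norm (t - t0)) \<le> exp (2 * M * (d + norm (x - t0)))"
        using M by simp
      then have "(1/2)^n / M * exp (2 * M * norm (t - t0)) \<le> (1/2)^n / M * exp (2 * M * (d + norm (x - t0)))"
        using M by (intro mult_left_mono) auto
      then show "norm (u (Suc n) t - u n t) \<le> (1/2)^n / M * exp (2 * M * (d + norm (x - t0)))"
        using diff_bound[of t n] t that by auto
    next
      show "summable (\<lambda>n. (1/2)^n / M * exp (2 * M * (d + norm (x - t0))))"
        by (intro summable_mult2 summable_divide summable_geometric) auto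
    qed
    from uniform_limit_add[OF uniform_limit_const this, of "u 0"]
    show ?thesis
      unfolding f_def by (simp add: sum_lessThan_telescope[of "\<lambda>n. u n _"])
  qed
  \<comment> \<open>The index is shifted below because the recursion gives the derivatives of
    \<open>u (Suc n)\<close>.\<close>
  have "\<exists>g'. \<forall>x\<in>D. (f has_field_derivative g' x) (at x) \<and> (\<lambda>n. F x (u n x)) \<longlonglongrightarrow> g' x"
  proof (rule has_complex_derivative_uniform_sequence[OF opD, where f = "\<lambda>n. u (Suc n)"])
    fix x assume "x \<in> D"
    then obtain d where d: "d > 0" "cball x d \<subseteq> D"
      using opD open_contains_cball by blast
    have "uniform_limit (cball x d) (\<lambda>n. u (Suc n)) f sequentially"
      using filterlim_compose[OF unif[OF d(2)] filterlim_Suc] .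
    then show "\<exists>d>0. cball x d \<subseteq> D \<and> uniform_limit (cball x d) (\<lambda>n. u (Suc n)) f sequentially"
      using d by blast
  qed (use u(2) in auto)
  then obtain g' where g': "\<And>x. x \<in> D \<Longrightarrow> (f has_field_derivative g' x) (at x)"
      "\<And>x. x \<in> D \<Longrightarrow> (\<lambda>n. F x (u n x)) \<longlonglongrightarrow> g' x"
    by blast
  have lim: "(\<lambda>n. u n x) \<longlonglongrightarrow> f x" if "x \<in> D" for x
  proof -
    obtain d where "d > 0" "cball x d \<subseteq> D"
      using opD open_contains_cball \<open>x \<in> D\<close> by blast
    then show ?thesis
      using tendsto_uniform_limitI[OF unif, of x d x] by auto
  qed
  have f_below: "Re (f x) \<le> m" if x: "x \<in> D" for x
  proof (rule below[OF x])
    have "(\<lambda>n. norm (u n x - w0 - (x - t0))) \<longlonglongrightarrow> norm (f x - w0 - (x - t0))"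
      by (intro tendsto_intros lim x)
    then show "norm (f x - w0 - (x - t0)) \<le> c * norm (x - t0)"
      by (rule LIMSEQ_le_const2) (use near[OF x] in auto)
  qed
  \<comment> \<open>Lipschitz continuity identifies the limit of \<open>F x (u n x)\<close>, which
    is already known to be the derivative of \<open>f\<close>.\<close>
  have "g' x = F x (f x)" if x: "x \<in> D" for x
  proof -
    have "(\<lambda>n. M * norm (u n x - f x)) \<longlonglongrightarrow> M * norm (f x - f x)"
      by (intro tendsto_intros lim x)
    then have null: "(\<lambda>n. M * norm (u n x - f x)) \<longlonglongrightarrow> 0"
      by simp
    have le: "norm (F x (u n x) - F x (f x)) \<le> M * norm (u n x - f x)" for n
      by (rule M(2)[OF _ below[OF x near[OF x]] f_below[OF x]]) (use x DH in auto)
    have "(\<lambda>n. F x (u n x) - F x (f x)) \<longlonglongrightarrow> 0"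
      by (rule Lim_null_comparison[OF always_eventually null]) (use le in blast)
    then have "(\<lambda>n. F x (u n x)) \<longlonglongrightarrow> F x (f x)"
      by (simp add: LIM_zero_iff)
    then show ?thesis
      by (rule LIMSEQ_unique[OF g'(2)[OF x]])
  qed
  then have "solution D f"
    using opD DH g'(1) f_below m unfolding solution_def by fastforce
  moreover have "f t0 = w0"
    using lim[OF t0D] u(1) by (simp add: adm_def LIMSEQ_const_iff)
  ultimately show ?thesis
    using that cvD bcD t0D convex_connected by blast
qed

text \<open>Every competitor that meets the graph in some point has to be absorbed, wherever that
  point lies. This is the form in which maximality shows graphs to be closed in the leaf
  topology.\<close>

definition maximal_solution :: "complex set \<Rightarrow> (complex \<Rightarrow> complex) \<Rightarrow> bool" where
  "maximal_solution U f \<longleftrightarrow> solution U f \<and> connected U \<and> backward_closed H U \<and>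
     (\<forall>V g t. solution V g \<longrightarrow> connected V \<longrightarrow> backward_closed H V \<longrightarrow>
        t \<in> U \<inter> V \<longrightarrow> f t = g t \<longrightarrow> V \<subseteq> U \<and> (\<forall>s\<in>V. g s = f s))"

text \<open>Take the union of all solutions through \<open>(t0, w0)\<close> over connected backward
  closed sets. They agree wherever two are defined, because the overlap of their domains is
  connected.\<close>

lemma maximal_solution_exists:
  assumes "t0 \<in> H" "Re w0 < \<mu>"
  obtains U f where "maximal_solution U f" "t0 \<in> U" "f t0 = w0"
proof -
  define \<F> where "\<F> = {(V, g). solution V g \<and> connected V \<and> backward_closed H V \<and> t0 \<in> V \<and> g t0 = w0}"
  have conn: "connected (V \<inter> W)" if "solution V g" "connected V" "backward_closed H V"
    "solution W h" "connected W" "backward_closed H W" for V W g h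
    using that connected_Int_backward_closed[of V lam \<kappa> W] by (auto simp: solution_def)
  have agree: "g t = h t" if "(V, g) \<in> \<F>" "(W, h) \<in> \<F>" "t \<in> V \<inter> W" for V W g h t
    using that conn[of V g W h] solution_glue(2)[of V g W h t0 t] by (auto simp: \<F>_def)
  define U where "U = (\<Union>(V, g)\<in>\<F>. V)"
  \<comment> \<open>By \<open>agree\<close>, all members of \<open>\<F>\<close> defined at
    \<open>t\<close> have the same value there, so the choice is unambiguous on
    \<open>U\<close>.\<close>
  define f where "f t = (SOME w. \<exists>V g. (V, g) \<in> \<F> \<and> t \<in> V \<and> g t = w)" for t
  have f: "f t = g t" if "(V, g) \<in> \<F>" "t \<in> V" for V g t
  proof -
    have "\<exists>V h. (V, h) \<in> \<F> \<and> t \<in> V \<and> h t = f t"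
      unfolding f_def using that by (intro someI_ex[of "\<lambda>w. \<exists>V g. (V, g) \<in> \<F> \<and> t \<in> V \<and> g t = w"]) blast
    then show ?thesis
      using agree that by (metis IntI)
  qed
  have solf: "solution U f"
    unfolding solution_def
  proof (intro conjI ballI)
    show "open U" "U \<subseteq> H"
      unfolding U_def by (auto simp: \<F>_def solution_def)
    fix t assume "t \<in> U"
    then obtain V g where Vg: "(V, g) \<in> \<F>" "t \<in> V"
      by (auto simp: U_def)
    then have g: "open V" "Re (g t) < \<mu>" "(g has_field_derivative F t (g t)) (at t)"
      by (auto simp: \<F>_def solution_def)
    show "Re (f t) < \<mu>"
      using f[OF Vg] g by simp
    show "(f has_field_derivative F t (f t)) (at t)"
      using has_field_derivative_transform_within_open[OF g(3,1) Vg(2), of f] f[OF Vg(1)] Vg(2) by simp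
  qed
  have connU: "connected U"
    unfolding U_def by (rule connected_Union) (auto simp: \<F>_def)
  have bcU: "backward_closed H U"
    unfolding backward_closed_def
  proof (intro ballI allI impI)
    fix t and s :: real assume *: "t \<in> U" "s \<ge> 0" "t - of_real s \<in> H"
    then obtain V g where Vg: "(V, g) \<in> \<F>" "t \<in> V"
      by (auto simp: U_def)
    then have "t - of_real s \<in> V"
      using * unfolding \<F>_def backward_closed_def by blast
    then show "t - of_real s \<in> U"
      using Vg(1) by (auto simp: U_def)
  qed
  obtain D g where D: "(D, g) \<in> \<F>"
    using solution_exists[OF assms] unfolding \<F>_def by blast
  then have t0: "t0 \<in> U" "f t0 = w0"
    using f[OF D] by (auto simp: U_def \<F>_def)
  \<comment> \<open>Gluing a competitor to \<open>f\<close> gives a member of \<open>\<F>\<close>,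
    whose domain is already part of the union \<open>U\<close>.\<close>
  have max: "V \<subseteq> U \<and> (\<forall>s\<in>V. g s = f s)"
    if V: "solution V g" "connected V" "backward_closed H V" and t: "t \<in> U \<inter> V" "f t = g t" for V g t
  proof -
    note glue = solution_glue[OF solf V(1) conn[OF solf connU bcU V] t]
    have "connected (U \<union> V)"
      using connU V(2) t by (intro connected_Un) auto
    moreover have "backward_closed H (U \<union> V)"
      using bcU V(3) unfolding backward_closed_def by blast
    ultimately have "(U \<union> V, \<lambda>t. if t \<in> U then f t else g t) \<in> \<F>"
      using glue(1) t0 by (auto simp: \<F>_def)
    then have "U \<union> V \<subseteq> U"
      unfolding U_def by blast
    then show ?thesis
      using glue(2) by auto
  qed
  show ?thesis
    using that[of U f] t0 solf connU bcU max unfolding maximal_solution_def by blast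
qed

end

subsection \<open>Leaves as graphs of maximal solutions\<close>

text \<open>The maps exhibit \<open>Y\<close> as a retract of \<open>U\<close>: a loop in
  \<open>Y\<close> is projected to \<open>U\<close> and contracted there, and the homotopy is mapped
  back by \<open>\<Gamma>\<close>.\<close>

lemma simply_connected_space_retract:
  fixes U :: "'a :: real_normed_vector set"
  assumes U: "simply_connected U"
    and \<Gamma>: "continuous_map (top_of_set U) Y \<Gamma>" and \<pi>: "continuous_map Y (top_of_set U) \<pi>"
    and inv: "\<And>y. y \<in> topspace Y \<Longrightarrow> \<Gamma> (\<pi> y) = y"
  shows "simply_connected_space Y"
  unfolding simply_connected_space_def
proof (intro conjI allI impI)
  have \<pi>U: "\<pi> y \<in> U" if "y \<in> topspace Y" for y
    using \<pi> that by (auto simp: continuous_map_def)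
  have "\<Gamma> ` U = topspace Y"
  proof
    show "\<Gamma> ` U \<subseteq> topspace Y"
      using \<Gamma> by (auto simp: continuous_map_def)
    show "topspace Y \<subseteq> \<Gamma> ` U"
      using inv \<pi>U by force
  qed
  moreover have "path_connectedin Y (\<Gamma> ` U)"
    using path_connectedin_continuous_map_image[OF \<Gamma>, of U] simply_connected_imp_path_connected[OF U]
    by (simp add: path_connectedin_subtopology)
  ultimately show "path_connected_space Y"
    by (simp add: path_connectedin_topspace)
  fix g assume g: "pathin Y g \<and> g 1 = g 0"
  have gY: "g x \<in> topspace Y" if "x \<in> {0..1}" for x
    using g that by (auto simp: pathin_def continuous_map_def)
  have "continuous_map (top_of_set {0..1}) (top_of_set U) (\<pi> \<circ> g)"
    using g continuous_map_compose[OF _ \<pi>] unfolding pathin_def by blast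
  then have "path (\<pi> \<circ> g)" "path_image (\<pi> \<circ> g) \<subseteq> U"
    by (auto simp: path_def path_image_def continuous_map_in_subtopology)
  then have "homotopic_loops U (\<pi> \<circ> g) (linepath (\<pi> (g 0)) (\<pi> (g 0)))"
    using U g \<pi>U gY unfolding simply_connected_eq_contractible_loop_any
    by (auto simp: pathfinish_def pathstart_def)
  then have "homotopic_with (\<lambda>h. h 1 = h 0) (top_of_set {0..1}) Y
      (\<Gamma> \<circ> (\<pi> \<circ> g)) (\<Gamma> \<circ> linepath (\<pi> (g 0)) (\<pi> (g 0)))"
    unfolding homotopic_loops_def
    by (rule homotopic_with_compose_continuous_map_left[OF _ \<Gamma>]) (simp add: pathfinish_def pathstart_def)
  then show "homotopic_with (\<lambda>h. h 1 = h 0) (top_of_set {0..1}) Y g (\<lambda>_. g 0)"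
    by (rule homotopic_with_eq)
      (use gY inv in \<open>auto simp: linepath_def simp flip: scaleR_left.add\<close>)
qed

text \<open>In the time \<open>t = z / lam\<close> the pulled-back field becomes a scalar equation
  for \<open>w\<close>; the exponential turns the radii into the bounds \<open>ln \<rho>\<close> and
  \<open>ln r\<close> on real parts.\<close>

locale pullback_foliation =
  forward_ode lam "ln \<rho>" "ln r" c "\<lambda>t w. 1 + R (exp (lam * t), exp w)"
  for lam :: complex and \<rho> r c :: real and R :: "complex \<times> complex \<Rightarrow> complex" +
  assumes lam_nonzero: "lam \<noteq> 0"
begin

abbreviation "V \<equiv> pullback_field lam R"
abbreviation "S \<equiv> cover_dom \<rho> r"
abbreviation "X \<equiv> leaf_topology V S"

definition graph :: "complex set \<Rightarrow> (complex \<Rightarrow> complex) \<Rightarrow> (complex \<times> complex) set" where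
  "graph U f = (\<lambda>t. (lam * t, f t)) ` U"

lemma mem_graph_iff: "(lam * t, w) \<in> graph U f \<longleftrightarrow> t \<in> U \<and> w = f t"
  using lam_nonzero by (auto simp: graph_def)

lemma integral_curve_solution:
  assumes "solution U f" "connected U"
  shows "integral_curve V S U (\<lambda>t. (lam * t, f t))"
  unfolding integral_curve_def
proof (intro conjI ballI)
  show "open U" "connected U"
    using assms by (auto simp: solution_def)
  show "(\<lambda>t. (lam * t, f t)) ` U \<subseteq> S"
    using assms by (auto simp: solution_def cover_dom_def half_plane_def)
  fix t assume "t \<in> U"
  then have "(f has_derivative (\<lambda>h. h * (1 + R (exp (lam * t), exp (f t))))) (at t)"
    using assms by (simp add: solution_def has_field_derivative_def mult_commute_abs)
  moreover have "((\<lambda>t. lam * t) has_derivative (\<lambda>h. h * lam)) (at t)"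
    by (auto intro!: derivative_eq_intros)
  ultimately show "((\<lambda>t. (lam * t, f t)) has_derivative
      (\<lambda>h. (h * fst (V (lam * t, f t)), h * snd (V (lam * t, f t))))) (at t)"
    by (auto simp: pullback_field_def covE_def intro: has_derivative_Pair)
qed

text \<open>The first coordinate has constant derivative \<open>lam\<close> on a connected domain,
  so it is \<open>lam * t\<close> after a shift of time. Thus all generators of the leaf topology
  are graphs of solutions.\<close>

lemma integral_curve_image_is_graph:
  assumes \<gamma>: "integral_curve V S D \<gamma>" and W: "open W" "W \<subseteq> D"
  obtains U f where "solution U f" "\<gamma> ` W = graph U f"
proof -
  have D: "open D" "connected D"
    using \<gamma> by (auto simp: integral_curve_def)
  have der: "((\<lambda>t. fst (\<gamma> t)) has_field_derivative lam) (at t)"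
    "((\<lambda>t. snd (\<gamma> t)) has_field_derivative 1 + R (exp (fst (\<gamma> t)), exp (snd (\<gamma> t)))) (at t)"
    if "t \<in> D" for t
  proof -
    have *: "(\<gamma> has_derivative (\<lambda>h. (h * fst (V (\<gamma> t)), h * snd (V (\<gamma> t))))) (at t)"
      using \<gamma> that by (auto simp: integral_curve_def)
    show "((\<lambda>t. fst (\<gamma> t)) has_field_derivative lam) (at t)"
      using has_derivative_fst[OF *]
      by (simp add: has_field_derivative_def pullback_field_def mult_commute_abs)
    show "((\<lambda>t. snd (\<gamma> t)) has_field_derivative 1 + R (exp (fst (\<gamma> t)), exp (snd (\<gamma> t)))) (at t)"
      using has_derivative_snd[OF *]
      by (simp add: has_field_derivative_def pullback_field_def covE_def mult_commute_abs)
  qed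
  have der0: "((\<lambda>t. fst (\<gamma> t) - lam * t) has_field_derivative 0) (at t)" if "t \<in> D" for t
    using der(1)[OF that] by (auto intro!: derivative_eq_intros)
  have "continuous_on D (\<lambda>t. fst (\<gamma> t) - lam * t)"
    using der0 by (intro continuous_at_imp_continuous_on ballI DERIV_isCont)
  then obtain k where k: "\<And>t. t \<in> D \<Longrightarrow> fst (\<gamma> t) - lam * t = k"
    using DERIV_zero_connected_constant[OF D(2,1) finite.emptyI] der0 by auto
  define a where "a = k / lam"
  have fst_\<gamma>: "fst (\<gamma> t) = lam * (a + t)" if "t \<in> D" for t
    using k[OF that] lam_nonzero by (simp add: a_def algebra_simps)
  define f where "f t = snd (\<gamma> (t - a))" for t
  have "solution ((+) a ` W) f"
    unfolding solution_def
  proof (intro conjI ballI)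
    show "open ((+) a ` W)"
      using W by (intro open_translation)
    have \<gamma>S: "\<gamma> t \<in> S" if "t \<in> W" for t
      using that W \<gamma> by (auto simp: integral_curve_def)
    show "(+) a ` W \<subseteq> H"
    proof clarify
      fix t assume "t \<in> W"
      then show "a + t \<in> H"
        using \<gamma>S[of t] fst_\<gamma>[of t] W by (auto simp: cover_dom_def half_plane_def case_prod_beta)
    qed
    fix t assume "t \<in> (+) a ` W"
    then have t: "t - a \<in> W" "t - a \<in> D"
      using W by auto
    show "Re (f t) < ln r"
      using \<gamma>S[OF t(1)] by (auto simp: cover_dom_def f_def case_prod_beta)
    have "((\<lambda>t. snd (\<gamma> (t + (- a)))) has_field_derivative 1 + R (exp (fst (\<gamma> (t - a))), exp (snd (\<gamma> (t - a))))) (at t)"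
      using der(2)[OF t(2)] DERIV_shift[of "\<lambda>t. snd (\<gamma> t)" _ t "- a"] by simp
    then show "(f has_field_derivative 1 + R (exp (lam * t), exp (f t))) (at t)"
      using fst_\<gamma>[OF t(2)] by (simp add: f_def[abs_def])
  qed
  moreover have "\<gamma> ` W = graph ((+) a ` W) f"
    unfolding graph_def image_image
    using fst_\<gamma> W by (intro image_cong) (auto simp: f_def prod_eq_iff)
  ultimately show ?thesis
    using that by blast
qed

text \<open>Integral curves have connected domains while \<open>U\<close> may be disconnected, so
  the graph is covered by graphs over balls.\<close>

lemma openin_graph:
  assumes "solution U f"
  shows "openin X (graph U f)"
proof (subst openin_subopen, intro ballI)
  fix q assume "q \<in> graph U f"
  then obtain t where t: "t \<in> U" "q = (lam * t, f t)"
    by (auto simp: graph_def)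
  obtain e where e: "e > 0" "ball t e \<subseteq> U"
    using t assms open_contains_ball unfolding solution_def by blast
  have "integral_curve V S (ball t e) (\<lambda>t. (lam * t, f t))"
    using e solution_subset[OF assms] by (intro integral_curve_solution) auto
  then have "openin X (graph (ball t e) f)"
    unfolding leaf_topology_def graph_def
    by (intro topology_generated_by_Basis) blast
  then show "\<exists>T. openin X T \<and> q \<in> T \<and> T \<subseteq> graph U f"
    using t e by (intro exI[of _ "graph (ball t e) f"]) (auto simp: graph_def)
qed

text \<open>It suffices to test generators. These are graphs, so the preimage is the set where two
  solutions coincide, open by local uniqueness.\<close>

lemma continuous_map_graph:
  assumes f: "solution U f"
  shows "continuous_map (top_of_set U) X (\<lambda>t. (lam * t, f t))"
proof -
  have "(\<lambda>t. (lam * t, f t)) ` U \<subseteq> topspace X"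
    using openin_subset[OF openin_graph[OF f]] by (simp add: graph_def)
  moreover have "openin (top_of_set U) ((\<lambda>t. (lam * t, f t)) -` (\<gamma> ` W) \<inter> U)"
    if W: "integral_curve V S D \<gamma>" "open W" "W \<subseteq> D" for \<gamma> D W
  proof -
    obtain U' g where g: "solution U' g" "\<gamma> ` W = graph U' g"
      by (rule integral_curve_image_is_graph[OF W])
    have eq: "(\<lambda>t. (lam * t, f t)) -` (\<gamma> ` W) \<inter> U = {t \<in> U \<inter> U'. f t = g t}"
      unfolding g(2) by (auto simp: mem_graph_iff)
    have sol: "solution (U \<inter> U') f" "solution (U \<inter> U') g"
      by (rule solution_subset[OF f] solution_subset[OF g(1)]; use f g(1) in \<open>auto simp: solution_def\<close>)+
    have "open {t \<in> U \<inter> U'. f t = g t}"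
      unfolding open_contains_ball
    proof
      fix t assume "t \<in> {t \<in> U \<inter> U'. f t = g t}"
      then obtain e where "e > 0" "ball t e \<subseteq> U \<inter> U'" "\<And>s. s \<in> ball t e \<Longrightarrow> f s = g s"
        using solutions_agree_locally[OF sol, of t] by blast
      then show "\<exists>e>0. ball t e \<subseteq> {t \<in> U \<inter> U'. f t = g t}"
        by blast
    qed
    then show ?thesis
      unfolding eq by (intro open_subset) auto
  qed
  ultimately show ?thesis
    unfolding leaf_topology_def topology_generated_by_topspace
    by (intro continuous_on_generated_topo) auto
qed

lemma topspace_leaf_topology: "topspace X \<subseteq> S"
  unfolding leaf_topology_def topology_generated_by_topspace by (auto simp: integral_curve_def)

lemma cover_dom_cases:
  assumes "p \<in> S"
  obtains t w where "p = (lam * t, w)" "t \<in> H" "Re w < ln r"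
proof (rule that)
  show "p = (lam * (fst p / lam), snd p)"
    using lam_nonzero by simp
  show "fst p / lam \<in> H" "Re (snd p) < ln r"
    using assms lam_nonzero by (auto simp: cover_dom_def half_plane_def simp del: times_complex.sel)
qed

text \<open>The graph is connected, open and closed in the leaf topology, hence a connected
  component.\<close>

lemma leaf_eq_graph:
  assumes U: "maximal_solution U f" and t0: "t0 \<in> U"
  shows "leaf V S (lam * t0, f t0) = graph U f"
proof -
  have f: "solution U f" "connected U"
    using U by (auto simp: maximal_solution_def)
  have conn: "connectedin X (graph U f)"
    using connectedin_continuous_map_image[OF continuous_map_graph[OF f(1)], of U] f(2)
    by (simp add: graph_def connectedin_subtopology)
  have "openin X (topspace X - graph U f)"
  proof (subst openin_subopen, intro ballI)
    fix q assume q: "q \<in> topspace X - graph U f"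
    then obtain t w where tw: "q = (lam * t, w)" "t \<in> H" "Re w < ln r"
      using topspace_leaf_topology cover_dom_cases by blast
    then obtain D g where g: "solution D g" "connected D" "backward_closed H D" "t \<in> D" "g t = w"
      using solution_exists by blast
    \<comment> \<open>If a solution through a point off the graph met the graph, maximality would
      put all of that solution, including the point, on the graph.\<close>
    have "graph D g \<inter> graph U f = {}"
    proof (rule ccontr)
      assume "graph D g \<inter> graph U f \<noteq> {}"
      then obtain s where "s \<in> U \<inter> D" "f s = g s"
        using lam_nonzero by (fastforce simp: graph_def)
      then have "D \<subseteq> U \<and> (\<forall>s\<in>D. g s = f s)"
        using U g unfolding maximal_solution_def by blast
      then show False
        using q tw g by (auto simp: mem_graph_iff)
    qed
    then show "\<exists>T. openin X T \<and> q \<in> T \<and> T \<subseteq> topspace X - graph U f"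
      using openin_graph[OF g(1)] openin_subset[OF openin_graph[OF g(1)]] g tw
      by (intro exI[of _ "graph D g"]) (auto simp: mem_graph_iff)
  qed
  then have clo: "closedin X (graph U f)"
    using openin_subset[OF openin_graph[OF f(1)]] by (simp add: closedin_def)
  have mem: "(lam * t0, f t0) \<in> graph U f"
    using t0 by (simp add: mem_graph_iff)
  have "connected_component_of_set X (lam * t0, f t0) \<subseteq> graph U f"
  proof -
    have "(lam * t0, f t0) \<in> connected_component_of_set X (lam * t0, f t0)"
      using connected_component_of_maximal[OF conn mem] mem by blast
    then show ?thesis
      using connectedin_clopen_cases[OF connectedin_connected_component_of clo openin_graph[OF f(1)]] mem
      by (auto simp: disjnt_iff)
  qed
  then show ?thesis
    unfolding leaf_def using connected_component_of_maximal[OF conn mem] by blast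
qed

text \<open>Projection to time inverts the parametrisation of the leaf, so the leaf inherits simple
  connectivity from the base \<open>U\<close> of its graph.\<close>

lemma simply_connected_leaf:
  assumes "p \<in> S"
  shows "simply_connected_space (subtopology X (leaf V S p))"
proof -
  obtain t w where p: "p = (lam * t, w)" "t \<in> H" "Re w < ln r"
    using assms cover_dom_cases by blast
  obtain U f where U: "maximal_solution U f" "t \<in> U" "f t = w"
    using maximal_solution_exists[OF p(2,3)] .
  have f: "solution U f" "connected U" "backward_closed H U"
    using U by (auto simp: maximal_solution_def)
  have "simply_connected_space (subtopology X (graph U f))" (is "simply_connected_space ?Y")
  proof (rule simply_connected_space_retract[where \<Gamma> = "\<lambda>t. (lam * t, f t)" and \<pi> = "\<lambda>q. fst q / lam"])
    show "simply_connected U"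
      using f by (intro simply_connected_backward_closed) (auto simp: solution_def)
    show "continuous_map (top_of_set U) ?Y (\<lambda>t. (lam * t, f t))"
      using continuous_map_graph[OF f(1)]
      by (intro continuous_map_into_subtopology) (auto simp: graph_def)
    have topY: "topspace ?Y = graph U f"
      using openin_subset[OF openin_graph[OF f(1)]] by auto
    show "(lam * (fst q / lam), f (fst q / lam)) = q" if "q \<in> topspace ?Y" for q
      using that lam_nonzero unfolding topY by (auto simp: graph_def)
    \<comment> \<open>The preimage of an open \<open>W\<close> is the graph over \<open>W\<close>,
      which is open in the leaf topology.\<close>
    show "continuous_map ?Y (top_of_set U) (\<lambda>q. fst q / lam)"
      unfolding continuous_map_def topY
    proof (intro conjI allI impI)
      show "(\<lambda>q. fst q / lam) \<in> graph U f \<rightarrow> topspace (top_of_set U)"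
        using lam_nonzero by (auto simp: graph_def)
      fix W assume W: "openin (top_of_set U) W"
      then have "open W" "W \<subseteq> U"
        using f by (auto simp: solution_def openin_open_eq)
      then have "openin X (graph W f)"
        using f solution_subset by (intro openin_graph) blast
      moreover have "{q \<in> graph U f. fst q / lam \<in> W} = graph W f"
        using lam_nonzero \<open>W \<subseteq> U\<close> by (auto simp: graph_def)
      ultimately show "openin ?Y {q \<in> graph U f. fst q / lam \<in> W}"
        using \<open>W \<subseteq> U\<close> unfolding openin_subtopology
        by (intro exI[of _ "graph W f"]) (auto simp: graph_def)
    qed
  qed
  then show ?thesis
    using leaf_eq_graph[OF U(1,2)] p U by simp
qed

end

section \<open>Checking the hypotheses on the equation for \<open>R\<close>\<close>

lemma holomorphic_on_holo2_compose:
  assumes R: "holo2 R A" and U: "open U" "u holomorphic_on U" "v holomorphic_on U"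
    and A: "\<And>t. t \<in> U \<Longrightarrow> (u t, v t) \<in> A"
  shows "(\<lambda>t. R (u t, v t)) holomorphic_on U"
  unfolding holomorphic_on_open[OF U(1)]
proof
  fix t assume t: "t \<in> U"
  obtain a b where ab: "(R has_derivative (\<lambda>(h, k). a * h + b * k)) (at (u t, v t))"
    using R A[OF t] unfolding holo2_def by blast
  obtain u' v' where uv: "(u has_field_derivative u') (at t)" "(v has_field_derivative v') (at t)"
    using U t holomorphic_on_open by metis
  have "((\<lambda>t. (u t, v t)) has_derivative (\<lambda>h. (u' * h, v' * h))) (at t)"
    using uv by (intro has_derivative_Pair) (auto simp: has_field_derivative_def)
  from has_derivative_compose[OF this ab]
  have "((\<lambda>t. R (u t, v t)) has_derivative (\<lambda>h. (a * u' + b * v') * h)) (at t)"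
    by (simp add: algebra_simps)
  then show "\<exists>f'. ((\<lambda>t. R (u t, v t)) has_field_derivative f') (at t)"
    by (auto simp: has_field_derivative_def)
qed

lemma exp_mem_polydisc:
  assumes "\<rho> > 0" "r > 0" "Re z < ln \<rho>" "Re w < ln r"
  shows "(exp z, exp w) \<in> polydisc \<rho> r"
proof -
  have "exp (Re z) < exp (ln \<rho>)" "exp (Re w) < exp (ln r)"
    using assms(3,4) by (simp_all only: exp_less_cancel_iff)
  then show ?thesis
    using assms(1,2) by (simp add: polydisc_def)
qed

text \<open>Cauchy's inequality on discs of radius \<open>(\<mu> - m) / 2\<close> bounds
  \<open>deriv h\<close> on the convex half plane \<open>Re w \<le> m\<close>. The constant is the
  same for all such \<open>h\<close>.\<close>

lemma left_half_plane_Lipschitz_if_bounded: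
  fixes h :: "complex \<Rightarrow> complex"
  assumes h: "h holomorphic_on {w. Re w < \<mu>}" and b: "\<And>w. Re w < \<mu> \<Longrightarrow> norm (h w) \<le> 1"
    and m: "m < \<mu>" and w: "Re w \<le> m" "Re w' \<le> m"
  shows "norm (h w - h w') \<le> 2 / (\<mu> - m) * norm (w - w')"
proof -
  have op: "open {w. Re w < \<mu>}"
    by (intro open_Collect_less continuous_intros)
  have cv: "convex {w. Re w \<le> m}"
    by (rule convex_halfspace_Re_le)
  show ?thesis
  proof (rule field_differentiable_bound[OF cv, where f' = "deriv h"])
    fix x assume "x \<in> {w. Re w \<le> m}"
    then have x: "Re x \<le> m" by simp
    then show "(h has_field_derivative deriv h x) (at x within {w. Re w \<le> m})"
      using holomorphic_derivI[OF h op] m by simp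
    define d where "d = (\<mu> - m) / 2"
    have d: "d > 0"
      using m by (simp add: d_def)
    have sub: "cball x d \<subseteq> {w. Re w < \<mu>}"
    proof
      fix y assume "y \<in> cball x d"
      then have "Re (y - x) \<le> d"
        using complex_Re_le_cmod[of "y - x"] by (simp add: dist_norm norm_minus_commute)
      then show "y \<in> {w. Re w < \<mu>}"
        using x m by (simp add: d_def field_simps)
    qed
    have "norm ((deriv ^^ 1) h x) \<le> fact 1 * 1 / d ^ 1"
    proof (rule Cauchy_inequality)
      show "h holomorphic_on ball x d" "continuous_on (cball x d) h"
        using h sub holomorphic_on_subset holomorphic_on_imp_continuous_on ball_subset_cball by blast+
      show "norm (h y) \<le> 1" if "norm (x - y) = d" for y
        using that sub by (intro b) (auto simp: dist_norm)
    qed (use d in auto)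
    then show "norm (deriv h x) \<le> 2 / (\<mu> - m)"
      by (simp add: d_def)
  qed (use w in auto)
qed

theorem theorem1:
  fixes lam :: complex and a :: nat and R :: "complex \<times> complex \<Rightarrow> complex"
    and \<rho> r :: real
  assumes "lam \<noteq> 0"
    and "a > 0"
    and "\<rho> > 0" and "r > 0"
    and "holo2 R (polydisc \<rho> r)"
    and "\<exists>S. holo2 S (polydisc \<rho> r) \<and> (\<forall>(x, y)\<in>polydisc \<rho> r. R (x, y) = x ^ a * S (x, y))"
    and "bounded (R ` polydisc \<rho> r)"
    and "(SUP p\<in>polydisc \<rho> r. norm (R p)) < 1"
  shows "(\<forall>p\<in>cover_dom \<rho> r. pullback_field lam R p \<noteq> 0) \<and>
         (\<forall>p\<in>cover_dom \<rho> r.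
            simply_connected_space
              (subtopology (leaf_topology (pullback_field lam R) (cover_dom \<rho> r))
                 (leaf (pullback_field lam R) (cover_dom \<rho> r) p)))"
proof -
  define c where "c = (SUP p\<in>polydisc \<rho> r. norm (R p))"
  have R_le: "norm (R p) \<le> c" if "p \<in> polydisc \<rho> r" for p
  proof -
    have "bdd_above ((\<lambda>p. norm (R p)) ` polydisc \<rho> r)"
      using assms(7) by (auto simp: bounded_iff bdd_above_def)
    then show ?thesis
      unfolding c_def using that by (rule cSUP_upper2) auto
  qed
  \<comment> \<open>The centre of the polydisc is a point where \<open>norm (R p) \<le> c\<close>
    yields \<open>0 \<le> c\<close>.\<close>
  have c: "0 \<le> c" "c < 1"
    using order_trans[OF norm_ge_zero R_le[of "(0, 0)"]] assms(3,4,8)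
    by (auto simp: polydisc_def c_def)
  interpret pullback_foliation lam \<rho> r c R
  proof
    fix U u
    assume *: "open U" "U \<subseteq> half_plane lam (ln \<rho>)" "u holomorphic_on U" "\<And>t. t \<in> U \<Longrightarrow> Re (u t) < ln r"
    show "(\<lambda>t. 1 + R (exp (lam * t), exp (u t))) holomorphic_on U"
      using * assms(3,4)
      by (intro holomorphic_intros holomorphic_on_holo2_compose[OF assms(5)] exp_mem_polydisc)
        (auto simp: half_plane_def)
  next
    fix t w assume "t \<in> half_plane lam (ln \<rho>)" "Re w < ln r"
    then show "norm (1 + R (exp (lam * t), exp w) - 1) \<le> c"
      using assms(3,4) R_le exp_mem_polydisc by (simp add: half_plane_def)
  next
    fix m assume m: "m < ln r"
    \<comment> \<open>For fixed \<open>t\<close>, the slice of \<open>R\<close> in \<open>w\<close>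
      is holomorphic and bounded by \<open>c < 1\<close>; the resulting constant is independent of
      \<open>t\<close>.\<close>
    have "norm (R (exp (lam * t), exp w) - R (exp (lam * t), exp w')) \<le> 2 / (ln r - m) * norm (w - w')"
      if t: "t \<in> half_plane lam (ln \<rho>)" and w: "Re w \<le> m" "Re w' \<le> m" for t w w'
    proof (rule left_half_plane_Lipschitz_if_bounded[OF _ _ m w])
      have mem: "(exp (lam * t), exp w) \<in> polydisc \<rho> r" if "Re w < ln r" for w
        using t that assms(3,4) by (intro exp_mem_polydisc) (auto simp: half_plane_def)
      show "(\<lambda>w. R (exp (lam * t), exp w)) holomorphic_on {w. Re w < ln r}"
        using mem by (intro holomorphic_on_holo2_compose[OF assms(5)] holomorphic_intros
            open_Collect_less continuous_intros) auto
      show "norm (R (exp (lam * t), exp w)) \<le> 1" if "Re w < ln r" for w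
        using R_le[OF mem[OF that]] c by simp
    qed
    then show "\<exists>M>0. \<forall>t\<in>half_plane lam (ln \<rho>). \<forall>w w'. Re w \<le> m \<longrightarrow> Re w' \<le> m \<longrightarrow>
        norm (1 + R (exp (lam * t), exp w) - (1 + R (exp (lam * t), exp w'))) \<le> M * norm (w - w')"
      using m by (intro exI[of _ "2 / (ln r - m)"]) auto
  qed (use c assms(1) in auto)
  \<comment> \<open>Regularity is visible in the first component of the field, the nonzero constant
    \<open>lam\<close>.\<close>
  show ?thesis
    using simply_connected_leaf assms(1) by (auto simp: pullback_field_def zero_prod_def)
qed

end
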